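(* Consider the random model below with $c=1$ and $f(x)=e^{-x}$, and let $\delta>0$. For any $m$ with $\frac{n^{1.5}\log n}{\delta}<m<n^2$, if $X=(x_1,\dots,x_m)$ is sampled uniformly at random, then with probability $1-o(1)$ the following holds: for any position vector $Y$ with the same vertex order as $X$ that is $\delta$-far from $X$, if a graph $G$ is sampled according to $X$, then with probability $1-o(1)$ we have $P_X(G)>P_Y(G)$.
   Context: Random model: for a position vector $Z=(z_1,\dots,z_m)\in[0,n]^m$, a graph $G$ on vertices $v_1,\dots,v_m$ is sampled according to $Z$ by including each edge $\{v_i,v_j\}$ independently with probability $e^{-|z_i-z_j|}$; the likelihood is $P_Z(G)=\prod_{\{i,j\}\in G} e^{-|z_i-z_j|}\prod_{\{i,j\}\notin G}(1-e^{-|z_i-z_j|})$. $X$ sampled uniformly at random means each $x_i$ is independent and uniform on $[0,n]$. $X,Y$ have the same vertex order if $x_i<x_j\iff y_i<y_j$ for all $i,j$; they are $\delta$-far if $|x_i-y_i|>\delta$ for some $i$. "With probability $1-o(1)$" means with probability $1-1/\mathrm{poly}(n)$. *)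

theory Defs
  imports "HOL-Probability.Probability"
begin

text \<open>
  Vertices are the numbers below m; the unordered pair of distinct vertices i, j is
  represented by the pair (i, j) with i < j, and a graph by its set of edges.
\<close>

definition vertex_pairs :: "nat \<Rightarrow> (nat \<times> nat) set" where
  "vertex_pairs m = {(i, j). i < j \<and> j < m}"

definition position_vectors :: "nat \<Rightarrow> nat \<Rightarrow> (nat \<Rightarrow> real) set" where
  "position_vectors n m = {..<m} \<rightarrow> {0..real n}"

definition edge_prob :: "(nat \<Rightarrow> real) \<Rightarrow> nat \<times> nat \<Rightarrow> real" where
  "edge_prob Z = (\<lambda>(i, j). exp (- \<bar>Z i - Z j\<bar>))"

definition random_graph :: "nat \<Rightarrow> (nat \<Rightarrow> real) \<Rightarrow> (nat \<times> nat) set pmf" where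
  "random_graph m Z =
     map_pmf (\<lambda>b. {e \<in> vertex_pairs m. b e})
       (Pi_pmf (vertex_pairs m) False (\<lambda>e. bernoulli_pmf (edge_prob Z e)))"

definition likelihood :: "nat \<Rightarrow> (nat \<Rightarrow> real) \<Rightarrow> (nat \<times> nat) set \<Rightarrow> real" where
  "likelihood m Z G =
     (\<Prod>e \<in> vertex_pairs m \<inter> G. edge_prob Z e) * (\<Prod>e \<in> vertex_pairs m - G. 1 - edge_prob Z e)"

definition uniform_positions :: "nat \<Rightarrow> nat \<Rightarrow> (nat \<Rightarrow> real) measure" where
  "uniform_positions n m = (\<Pi>\<^sub>M i\<in>{..<m}. uniform_measure lborel {0..real n})"

definition same_vertex_order :: "nat \<Rightarrow> (nat \<Rightarrow> real) \<Rightarrow> (nat \<Rightarrow> real) \<Rightarrow> bool" where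
  "same_vertex_order m X Y \<longleftrightarrow> (\<forall>i<m. \<forall>j<m. X i < X j \<longleftrightarrow> Y i < Y j)"

definition far :: "nat \<Rightarrow> real \<Rightarrow> (nat \<Rightarrow> real) \<Rightarrow> (nat \<Rightarrow> real) \<Rightarrow> bool" where
  "far m \<delta> X Y \<longleftrightarrow> (\<exists>i<m. \<bar>X i - Y i\<bar> > \<delta>)"

text \<open>
  A property of X that quantifies over all position vectors Y (an uncountable family) is not
  obviously measurable, and \<^const>\<open>measure\<close> is 0 on non-measurable sets.  Hence ``with
  probability at least q, P holds'' is read as: P holds throughout some event of probability
  at least q.
\<close>

definition holds_with_prob_ge :: "'a measure \<Rightarrow> real \<Rightarrow> ('a \<Rightarrow> bool) \<Rightarrow> bool" where
  "holds_with_prob_ge M q P \<longleftrightarrow> (\<exists>A \<in> sets M. measure M A \<ge> q \<and> (\<forall>x\<in>A. P x))"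

end

(*
By Markov's inequality for sqrt (P_Y / P_X), the probability under X that P_Y(G) >= P_X(G) is at
most the product over all pairs of the Bhattacharyya coefficients of the two edge distributions,
hence at most exp (- H / 2), where H is the sum of the squared Hellinger distances.  For pairs at
X-distance at most 2, each of these is bounded below by a multiple of min 1 |D u - D v|^2, where
D = X - Y is the displacement; this uses that X and Y have the same order.

With high probability each of the n unit cells contains at least m / (4n) points of X and there
are points close to both ends of [0, n].  As Y cannot leave [0, n], a displacement larger than
delta somewhere has to disappear on the way to one of the ends.  Cauchy-Schwarz along the chain
of at most n cells, all pairs between neighbouring cells being available, gives
H >= c (m / n)^2 delta^2 / n >= c' (ln n)^2.
*)
theory Submission
  imports Defs
begin

section \<open>Likelihood as the mass function of the random graph\<close>

lemma finite_vertex_pairs [simp]: "finite (vertex_pairs m)"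
  by (rule finite_subset[of _ "{..<m} \<times> {..<m}"]) (auto simp: vertex_pairs_def)

lemma edge_prob_bounds: "0 < edge_prob Z e" "edge_prob Z e \<le> 1"
  by (auto simp: edge_prob_def split: prod.splits)

lemma likelihood_nonneg: "0 \<le> likelihood m Z G"
  unfolding likelihood_def
  by (intro mult_nonneg_nonneg prod_nonneg) (auto simp: edge_prob_bounds less_imp_le)

lemma pmf_random_graph:
  assumes "G \<subseteq> vertex_pairs m"
  shows "pmf (random_graph m Z) G = likelihood m Z G"
proof -
  define M where
    "M = Pi_pmf (vertex_pairs m) False (\<lambda>e. bernoulli_pmf (edge_prob Z e))"
  have outside: "pmf M b = 0" if "\<exists>e. e \<notin> vertex_pairs m \<and> b e" for b
    unfolding M_def using that by (intro pmf_Pi_outside) auto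
  have "pmf (random_graph m Z) G = measure M ((\<lambda>b. {e \<in> vertex_pairs m. b e}) -` {G})"
    by (simp add: random_graph_def M_def pmf_map)
  \<comment> \<open>Any other member of the preimage is \<open>True\<close> somewhere outside
    \<open>vertex_pairs m\<close>, where \<open>Pi_pmf\<close> forces the default
    \<open>False\<close>; such functions carry no mass.\<close>
  also have "\<dots> = measure M {\<lambda>e. e \<in> G}"
  proof (rule measure_prob_cong_0)
    fix b assume "b \<in> (\<lambda>b. {e \<in> vertex_pairs m. b e}) -` {G} - {\<lambda>e. e \<in> G}"
    then have "b \<noteq> (\<lambda>e. e \<in> vertex_pairs m \<and> b e)" by auto
    then have "\<exists>e. e \<notin> vertex_pairs m \<and> b e" by (metis (full_types) ext)
    then show "pmf M b = 0" by (rule outside)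
  next
    fix b assume "b \<in> {\<lambda>e. e \<in> G} - (\<lambda>b. {e \<in> vertex_pairs m. b e}) -` {G}"
    then show "pmf M b = 0" using assms by auto
  qed
  also have "\<dots> = pmf M (\<lambda>e. e \<in> G)" by (simp add: measure_pmf_single)
  also have "\<dots> = (\<Prod>e\<in>vertex_pairs m. pmf (bernoulli_pmf (edge_prob Z e)) (e \<in> G))"
    unfolding M_def using assms by (intro pmf_Pi') auto
  also have "\<dots> = (\<Prod>e\<in>vertex_pairs m. if e \<in> G then edge_prob Z e else 1 - edge_prob Z e)"
    by (intro prod.cong) (auto simp: edge_prob_bounds less_imp_le)
  also have "\<dots> = likelihood m Z G"
    by (subst prod.If_cases) (auto simp: likelihood_def Int_def Diff_eq)
  finally show ?thesis .
qed

lemma set_pmf_random_graph: "set_pmf (random_graph m Z) \<subseteq> Pow (vertex_pairs m)"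
  by (auto simp: random_graph_def)

section \<open>Bhattacharyya bound on the error for a fixed Y\<close>

text \<open>Independence of the edges makes the Bhattacharyya coefficient multiplicative: expanding
  the product of two-term sums produces one summand per edge set.\<close>

lemma sum_sqrt_likelihood:
  "(\<Sum>G\<in>Pow (vertex_pairs m). sqrt (likelihood m X G * likelihood m Y G)) =
   (\<Prod>e\<in>vertex_pairs m. sqrt (edge_prob X e * edge_prob Y e) +
      sqrt ((1 - edge_prob X e) * (1 - edge_prob Y e)))"
proof -
  have sqrt_prod: "sqrt (prod f A) = (\<Prod>e\<in>A. sqrt (f e))" for f :: "nat \<times> nat \<Rightarrow> real" and A
    by (induction A rule: infinite_finite_induct) (auto simp: real_sqrt_mult)
  have "(\<Sum>G\<in>Pow (vertex_pairs m). sqrt (likelihood m X G * likelihood m Y G)) =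
      (\<Sum>G\<in>Pow (vertex_pairs m). (\<Prod>e\<in>G. sqrt (edge_prob X e * edge_prob Y e)) *
        (\<Prod>e\<in>vertex_pairs m - G. sqrt ((1 - edge_prob X e) * (1 - edge_prob Y e))))"
    by (intro sum.cong refl)
      (auto simp: likelihood_def Int_absorb1 Int_absorb2 sqrt_prod real_sqrt_mult prod.distrib ac_simps)
  then show ?thesis by (simp add: prod_add)
qed

text \<open>AM-GM bounds the non-edge term by \<open>1 - (p + q) / 2\<close>, which completes the
  square in \<open>sqrt p\<close> and \<open>sqrt q\<close>; then \<open>1 + x \<le> exp x\<close>
  applies.\<close>

lemma bhattacharyya_le:
  fixes p q :: real
  assumes "0 \<le> p" "p \<le> 1" "0 \<le> q" "q \<le> 1"
  shows "sqrt (p * q) + sqrt ((1 - p) * (1 - q)) \<le> exp (- (sqrt p - sqrt q)\<^sup>2 / 2)"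
proof -
  have "sqrt ((1 - p) * (1 - q)) \<le> ((1 - p) + (1 - q)) / 2"
    using assms by (intro arith_geo_mean_sqrt) auto
  moreover have "(sqrt p - sqrt q)\<^sup>2 = p + q - 2 * sqrt (p * q)"
    using assms by (simp add: power2_diff real_sqrt_mult)
  ultimately have "sqrt (p * q) + sqrt ((1 - p) * (1 - q)) \<le> 1 + - (sqrt p - sqrt q)\<^sup>2 / 2"
    by (simp add: field_simps)
  also have "\<dots> \<le> exp (- (sqrt p - sqrt q)\<^sup>2 / 2)" by (rule exp_ge_add_one_self)
  finally show ?thesis .
qed

text \<open>
  Only the edge term of the squared Hellinger distance of two Bernoulli variables; the non-edge
  term is dropped, so no singularity at edge probability 1 arises.
\<close>

definition hellinger :: "(nat \<Rightarrow> real) \<Rightarrow> (nat \<Rightarrow> real) \<Rightarrow> nat \<Rightarrow> nat \<Rightarrow> real" where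
  "hellinger X Y u v = (sqrt (edge_prob X (u, v)) - sqrt (edge_prob Y (u, v)))\<^sup>2"

text \<open>Passing to ordered pairs lets later sums over cells ignore which of two indices is
  smaller.\<close>

lemma sum_symmetric_vertex_pairs:
  fixes h :: "nat \<Rightarrow> nat \<Rightarrow> real"
  assumes "\<And>u v. h u v = h v u" "\<And>u. h u u = 0"
  shows "(\<Sum>(u, v)\<in>vertex_pairs m. h u v) = (\<Sum>u<m. \<Sum>v<m. h u v) / 2"
proof -
  define T where "T = (\<lambda>(u::nat, v). (v, u)) ` vertex_pairs m"
  define D where "D = (\<lambda>u. (u, u)) ` {..<m}"
  have "(\<Sum>u<m. \<Sum>v<m. h u v) = (\<Sum>(u, v)\<in>{..<m} \<times> {..<m}. h u v)"
    by (simp add: sum.cartesian_product)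
  also have "{..<m} \<times> {..<m} = vertex_pairs m \<union> (T \<union> D)"
    unfolding T_def D_def vertex_pairs_def by (auto simp: image_iff)
  also have "(\<Sum>(u, v)\<in>vertex_pairs m \<union> (T \<union> D). h u v) =
      (\<Sum>(u, v)\<in>vertex_pairs m. h u v) + ((\<Sum>(u, v)\<in>T. h u v) + (\<Sum>(u, v)\<in>D. h u v))"
    by (subst sum.union_disjoint; (subst sum.union_disjoint)?)
      (use finite_vertex_pairs[of m] in \<open>auto simp: T_def D_def vertex_pairs_def\<close>)
  also have "(\<Sum>(u, v)\<in>D. h u v) = 0"
    by (rule sum.neutral) (auto simp: D_def assms)
  also have "(\<Sum>(u, v)\<in>T. h u v) = (\<Sum>(u, v)\<in>vertex_pairs m. h u v)"
    unfolding T_def by (subst sum.reindex) (auto simp: inj_on_def assms(1) case_prod_unfold)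
  finally show ?thesis by simp
qed

lemma prob_likelihood_gt:
  "measure_pmf.prob (random_graph m X) {G. likelihood m X G > likelihood m Y G}
     \<ge> 1 - exp (- (\<Sum>u<m. \<Sum>v<m. hellinger X Y u v) / 4)"
proof -
  let ?V = "vertex_pairs m"
  define B where "B = {G. \<not> likelihood m X G > likelihood m Y G}"
  have "measure_pmf.prob (random_graph m X) B = measure_pmf.prob (random_graph m X) (B \<inter> Pow ?V)"
    using set_pmf_random_graph[of m X] by (intro measure_prob_cong_0) (auto simp: set_pmf_iff)
  also have "\<dots> = (\<Sum>G\<in>B \<inter> Pow ?V. pmf (random_graph m X) G)"
    by (rule measure_measure_pmf_finite) simp
  \<comment> \<open>On \<open>B\<close> the likelihood under X is at most its geometric mean with
    the one under Y. This is Markov's inequality for sqrt (P_Y / P_X), without dividing by a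
    likelihood that may vanish.\<close>
  also have "\<dots> \<le> (\<Sum>G\<in>B \<inter> Pow ?V. sqrt (likelihood m X G * likelihood m Y G))"
  proof (rule sum_mono)
    fix G assume G: "G \<in> B \<inter> Pow ?V"
    then have "likelihood m X G * likelihood m X G \<le> likelihood m X G * likelihood m Y G"
      by (intro mult_left_mono) (auto simp: B_def likelihood_nonneg)
    then have "likelihood m X G \<le> sqrt (likelihood m X G * likelihood m Y G)"
      by (intro real_le_rsqrt) (simp add: power2_eq_square)
    then show "pmf (random_graph m X) G \<le> sqrt (likelihood m X G * likelihood m Y G)"
      using G by (simp add: pmf_random_graph)
  qed
  also have "\<dots> \<le> (\<Sum>G\<in>Pow ?V. sqrt (likelihood m X G * likelihood m Y G))"
    by (rule sum_mono2) (auto simp: likelihood_nonneg)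
  also have "\<dots> \<le> (\<Prod>e\<in>?V. exp (- (sqrt (edge_prob X e) - sqrt (edge_prob Y e))\<^sup>2 / 2))"
    unfolding sum_sqrt_likelihood
    by (intro prod_mono conjI bhattacharyya_le add_nonneg_nonneg)
      (auto simp: edge_prob_bounds less_imp_le)
  also have "\<dots> = exp (- (\<Sum>(u, v)\<in>?V. hellinger X Y u v) / 2)"
    by (simp add: exp_sum[symmetric] sum_negf sum_divide_distrib hellinger_def case_prod_unfold)
  \<comment> \<open>Ordered pairs count every edge twice, so the 1/2 in the exponent becomes
    1/4.\<close>
  also have "(\<Sum>(u, v)\<in>?V. hellinger X Y u v) = (\<Sum>u<m. \<Sum>v<m. hellinger X Y u v) / 2"
    by (rule sum_symmetric_vertex_pairs)
      (auto simp: hellinger_def edge_prob_def abs_minus_commute)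
  finally have "measure_pmf.prob (random_graph m X) B
      \<le> exp (- (\<Sum>u<m. \<Sum>v<m. hellinger X Y u v) / 4)"
    by simp
  moreover have "measure_pmf.prob (random_graph m X) (- B) = 1 - measure_pmf.prob (random_graph m X) B"
    using measure_pmf.prob_compl[of B "random_graph m X"] by (simp add: Compl_eq_Diff_UNIV)
  moreover have "- B = {G. likelihood m X G > likelihood m Y G}" by (auto simp: B_def)
  ultimately show ?thesis by simp
qed

section \<open>Hellinger distance of a single pair\<close>

text \<open>On arguments up to 3 the function \<open>exp (- x / 2)\<close> falls with slope at least
  1/10, because \<open>exp (- 3 / 2) \<ge> 1 / 5\<close>; squaring gives the constant 100.\<close>

lemma exp_half_diff_ge:
  fixes d d' :: real
  assumes "0 \<le> d" "d \<le> 2" "0 \<le> d'"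
  shows "(exp (- d / 2) - exp (- d' / 2))\<^sup>2 \<ge> (min 1 \<bar>d - d'\<bar>)\<^sup>2 / 100"
proof -
  have aux: "exp (- x / 2) - exp (- y / 2) \<ge> (y - x) / 10" if "x \<le> y" "y \<le> 3" for x y :: real
  proof -
    have e: "1 / 5 \<le> exp (- y / 2)"
    proof -
      have "exp (1::real) ^ 3 \<le> (5::real)^2"
      proof -
        have "exp (1::real) ^ 3 \<le> (2.8::real) ^ 3" using e_less_272 by (intro power_mono) auto
        also have "\<dots> \<le> 5^2" by (simp add: power3_eq_cube)
        finally show ?thesis .
      qed
      then have "exp (3 / 2 :: real) ^ 2 \<le> (5::real)^2"
        by (simp flip: exp_of_nat_mult)
      then have "exp (3 / 2 :: real) \<le> 5" by (rule power2_le_imp_le) simp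
      moreover have "exp (y / 2) \<le> exp (3 / 2)" using that by simp
      ultimately have "exp (y / 2) \<le> 5" by linarith
      then show ?thesis by (simp add: exp_minus field_simps)
    qed
    have "1 + (y - x) / 2 \<le> exp ((y - x) / 2)" by (rule exp_ge_add_one_self)
    then have "exp (- y / 2) * (1 + (y - x) / 2) \<le> exp (- y / 2) * exp ((y - x) / 2)"
      by (intro mult_left_mono) auto
    also have "\<dots> = exp (- x / 2)" by (simp flip: exp_add add: field_simps)
    finally have "exp (- x / 2) - exp (- y / 2) \<ge> exp (- y / 2) * ((y - x) / 2)"
      by (simp add: algebra_simps)
    moreover have "1 / 5 * ((y - x) / 2) \<le> exp (- y / 2) * ((y - x) / 2)"
      using that e by (intro mult_right_mono) auto
    ultimately show ?thesis by simp
  qed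
  have "\<bar>exp (- d / 2) - exp (- d' / 2)\<bar> \<ge> min 1 \<bar>d - d'\<bar> / 10"
  proof (cases "d' \<le> d")
    case True
    then show ?thesis using aux[of d' d] assms by auto
  next
    case False
    \<comment> \<open>Truncating \<open>d'\<close> at distance 1 from \<open>d\<close> realises the
      cap and keeps \<open>y\<close> at most 3, where \<open>aux\<close> applies; beyond
      \<open>y\<close> monotonicity suffices.\<close>
    define y where "y = min d' (d + 1)"
    have eq: "y - d = min 1 \<bar>d - d'\<bar>" using False by (auto simp: y_def)
    have "exp (- d / 2) - exp (- y / 2) \<ge> (y - d) / 10"
      using assms False by (intro aux) (auto simp: y_def)
    moreover have "exp (- d' / 2) \<le> exp (- y / 2)" by (auto simp: y_def)
    ultimately have "min 1 \<bar>d - d'\<bar> / 10 \<le> exp (- d / 2) - exp (- d' / 2)"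
      unfolding eq[symmetric] by linarith
    then show ?thesis by linarith
  qed
  then have "(min 1 \<bar>d - d'\<bar> / 10)\<^sup>2 \<le> \<bar>exp (- d / 2) - exp (- d' / 2)\<bar>\<^sup>2"
    by (intro power_mono) auto
  then show ?thesis by (simp add: power_divide)
qed

text \<open>The common order gives \<open>X u - X v\<close> and \<open>Y u - Y v\<close> the same
  sign, so the two distances differ by exactly the difference of the displacements. A reflection of
  [0, n] preserves all distances and would defeat the bound.\<close>

lemma hellinger_ge:
  assumes "u < m" "v < m" "same_vertex_order m X Y" "\<bar>X u - X v\<bar> \<le> 2"
  shows "hellinger X Y u v \<ge> (min 1 \<bar>(X u - Y u) - (X v - Y v)\<bar>)\<^sup>2 / 100"
proof -
  have "X u < X v \<longleftrightarrow> Y u < Y v" "X v < X u \<longleftrightarrow> Y v < Y u"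
    using assms by (auto simp: same_vertex_order_def)
  then have "\<bar>\<bar>X u - X v\<bar> - \<bar>Y u - Y v\<bar>\<bar> = \<bar>(X u - Y u) - (X v - Y v)\<bar>"
    by linarith
  moreover have "sqrt (exp (- z)) = exp (- z / 2)" for z :: real
    by (rule real_sqrt_unique) (auto simp flip: exp_of_nat_mult)
  ultimately show ?thesis
    using exp_half_diff_ge[of "\<bar>X u - X v\<bar>" "\<bar>Y u - Y v\<bar>"] assms
    by (simp add: hellinger_def edge_prob_def)
qed

section \<open>Energy of the displacement along the chain of cells\<close>

text \<open>Jensen's inequality for the square over all pairs, proved with the tangent line at the
  difference \<open>t\<close> of the two means.\<close>

lemma sum_square_diff_ge:
  fixes f :: "'a \<Rightarrow> real"
  assumes "finite A" "finite B" "A \<noteq> {}" "B \<noteq> {}"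
  shows "(\<Sum>u\<in>A. \<Sum>v\<in>B. (f u - f v)\<^sup>2) \<ge>
    real (card A) * real (card B) * (sum f A / real (card A) - sum f B / real (card B))\<^sup>2"
proof -
  define a where "a = real (card A)"
  define b where "b = real (card B)"
  have ab: "a > 0" "b > 0" using assms by (auto simp: a_def b_def card_gt_0_iff)
  define t where "t = sum f A / a - sum f B / b"
  have "(\<Sum>u\<in>A. \<Sum>v\<in>B. (f u - f v)\<^sup>2) \<ge> (\<Sum>u\<in>A. \<Sum>v\<in>B. 2 * t * (f u - f v) - t\<^sup>2)"
  proof (intro sum_mono)
    fix u v
    have "0 \<le> (f u - f v - t)\<^sup>2" by simp
    then show "2 * t * (f u - f v) - t\<^sup>2 \<le> (f u - f v)\<^sup>2"
      by (simp add: power2_eq_square algebra_simps)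
  qed
  also have "(\<Sum>u\<in>A. \<Sum>v\<in>B. 2 * t * (f u - f v) - t\<^sup>2)
      = 2 * t * (b * sum f A - a * sum f B) - a * b * t\<^sup>2"
    by (simp add: sum_subtractf sum_distrib_left[symmetric] a_def b_def)
  also have "b * sum f A - a * sum f B = a * b * t"
    using ab by (simp add: t_def field_simps)
  also have "2 * t * (a * b * t) - a * b * t\<^sup>2 = a * b * t\<^sup>2"
    by (simp add: power2_eq_square algebra_simps)
  finally show ?thesis by (simp only: t_def a_def b_def)
qed

text \<open>Cauchy-Schwarz for the increments between \<open>p\<close> and \<open>q\<close>, by the
  same tangent argument. Dividing by \<open>n\<close> instead of \<open>q - p\<close> makes the
  bound independent of where the two indices lie.\<close>

lemma sum_square_increments_ge:
  fixes a :: "nat \<Rightarrow> real"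
  assumes "p \<le> q" "q < n"
  shows "(\<Sum>j<n - 1. (a (Suc j) - a j)\<^sup>2) \<ge> (a q - a p)\<^sup>2 / real n"
proof -
  define t where "t = (a q - a p) / real n"
  have n: "real n > 0" using assms by simp
  have "(a q - a p)\<^sup>2 / real n \<le> 2 * t * (a q - a p) - real (q - p) * t\<^sup>2"
  proof -
    have "real (q - p) * t\<^sup>2 \<le> real n * t\<^sup>2" using assms by (intro mult_right_mono) auto
    moreover have "real n * t\<^sup>2 = (a q - a p)\<^sup>2 / real n" "t * (a q - a p) = (a q - a p)\<^sup>2 / real n"
      using n by (auto simp: t_def power2_eq_square)
    ultimately show ?thesis by linarith
  qed
  also have "\<dots> = (\<Sum>j=p..<q. 2 * t * (a (Suc j) - a j) - t\<^sup>2)"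
    using sum_Suc_diff'[OF assms(1), of a]
    by (simp add: sum_subtractf sum_distrib_left[symmetric])
  also have "\<dots> \<le> (\<Sum>j=p..<q. (a (Suc j) - a j)\<^sup>2)"
  proof (intro sum_mono)
    fix j
    have "0 \<le> (a (Suc j) - a j - t)\<^sup>2" by simp
    then show "2 * t * (a (Suc j) - a j) - t\<^sup>2 \<le> (a (Suc j) - a j)\<^sup>2"
      by (simp add: power2_eq_square algebra_simps)
  qed
  also have "\<dots> \<le> (\<Sum>j<n - 1. (a (Suc j) - a j)\<^sup>2)"
    using assms by (intro sum_mono2) auto
  finally show ?thesis .
qed

lemma abs_mean_diff_le:
  fixes f :: "'a \<Rightarrow> real"
  assumes "finite A" "A \<noteq> {}" "\<And>u. u \<in> A \<Longrightarrow> \<bar>f u - c\<bar> \<le> e"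
  shows "\<bar>sum f A / real (card A) - c\<bar> \<le> e"
proof -
  have c: "real (card A) > 0" using assms by (auto simp: card_gt_0_iff)
  have "\<bar>sum f A - real (card A) * c\<bar> = \<bar>\<Sum>u\<in>A. f u - c\<bar>" by (simp add: sum_subtractf)
  also have "\<dots> \<le> (\<Sum>u\<in>A. \<bar>f u - c\<bar>)" by (rule sum_abs)
  also have "\<dots> \<le> real (card A) * e" using assms(3) by (intro sum_bounded_above) auto
  finally have "\<bar>sum f A - real (card A) * c\<bar> / real (card A) \<le> e"
    using c by (simp add: field_simps)
  moreover have "sum f A / real (card A) - c = (sum f A - real (card A) * c) / real (card A)"
    using c by (simp add: field_simps)
  ultimately show ?thesis by simp
qed

text \<open>
  If some close pair has displacements differing by \<eta>, then each vertex of its cell differs by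
  \<eta>/2 from one of the two.  Otherwise the cap 1 is never active, and the cell averages of
  the displacement carry the difference between D i and D w through at most n steps.
\<close>

lemma chain_energy_ge:
  fixes D :: "nat \<Rightarrow> real" and k :: "nat \<Rightarrow> nat" and h :: "nat \<Rightarrow> nat \<Rightarrow> real"
  assumes k: "\<And>u. u < m \<Longrightarrow> k u < n"
    and cells: "\<And>j. j < n \<Longrightarrow> real (card {u. u < m \<and> k u = j}) \<ge> N" and N: "N > 0"
    and h_nonneg: "\<And>u v. 0 \<le> h u v"
    and h: "\<And>u v. u < m \<Longrightarrow> v < m \<Longrightarrow> k u \<le> Suc (k v) \<Longrightarrow> k v \<le> Suc (k u) \<Longrightarrow>
      h u v \<ge> (min 1 \<bar>D u - D v\<bar>)\<^sup>2"
    and \<eta>: "0 < \<eta>" "\<eta> \<le> 1"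
    and i: "i < m" "w < m" "\<bar>D i - D w\<bar> \<ge> 4 * \<eta>"
  shows "(\<Sum>u<m. \<Sum>v<m. h u v) \<ge> min (N * \<eta>\<^sup>2 / 4) (4 * N\<^sup>2 * \<eta>\<^sup>2 / real n)"
proof -
  define C where "C j = {u. u < m \<and> k u = j}" for j
  have finC [simp]: "finite (C j)" for j by (simp add: C_def)
  have cardC: "real (card (C j)) \<ge> N" if "j < n" for j using cells[OF that] by (simp add: C_def)
  have neC: "C j \<noteq> {}" if "j < n" for j using cardC[OF that] N by auto
  show ?thesis
  proof (cases "\<exists>u<m. \<exists>v<m. k u \<le> Suc (k v) \<and> k v \<le> Suc (k u) \<and> \<bar>D u - D v\<bar> \<ge> \<eta>")
    case True
    then obtain u v where uv: "u < m" "v < m" "k u \<le> Suc (k v)" "k v \<le> Suc (k u)" "\<bar>D u - D v\<bar> \<ge> \<eta>"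
      by blast
    \<comment> \<open>Distinctness makes \<open>u\<close> and \<open>v\<close> contribute two
      different rows of the double sum.\<close>
    then have "u \<noteq> v" using \<eta> by auto
    have "N * \<eta>\<^sup>2 / 4 \<le> real (card (C (k u))) * (\<eta>\<^sup>2 / 4)"
      using mult_right_mono[OF cardC[OF k[OF uv(1)]], of "\<eta>\<^sup>2 / 4"] by simp
    also have "\<dots> = (\<Sum>z\<in>C (k u). \<eta>\<^sup>2 / 4)" by simp
    also have "\<dots> \<le> (\<Sum>z\<in>C (k u). h u z + h v z)"
    proof (rule sum_mono)
      fix z assume "z \<in> C (k u)"
      then have z: "z < m" "k z = k u" by (auto simp: C_def)
      have "(\<eta> / 2)\<^sup>2 \<le> h u z \<or> (\<eta> / 2)\<^sup>2 \<le> h v z"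
      proof (cases "\<bar>D u - D z\<bar> \<ge> \<eta> / 2")
        case True
        then have "(\<eta> / 2)\<^sup>2 \<le> (min 1 \<bar>D u - D z\<bar>)\<^sup>2" using \<eta> by (intro power_mono) auto
        then show ?thesis using h[of u z] uv z by auto
      next
        case False
        then have "\<bar>D v - D z\<bar> \<ge> \<eta> / 2" using uv by linarith
        then have "(\<eta> / 2)\<^sup>2 \<le> (min 1 \<bar>D v - D z\<bar>)\<^sup>2" using \<eta> by (intro power_mono) auto
        then show ?thesis using h[of v z] uv z by auto
      qed
      then show "\<eta>\<^sup>2 / 4 \<le> h u z + h v z"
        using h_nonneg[of u z] h_nonneg[of v z] by (auto simp: power_divide)
    qed
    also have "\<dots> \<le> (\<Sum>z<m. h u z + h v z)"
      by (rule sum_mono2) (auto simp: C_def h_nonneg)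
    also have "\<dots> = (\<Sum>x\<in>{u, v}. \<Sum>z<m. h x z)" using \<open>u \<noteq> v\<close> by (simp add: sum.distrib)
    also have "\<dots> \<le> (\<Sum>x<m. \<Sum>z<m. h x z)"
      using uv by (intro sum_mono2) (auto simp: h_nonneg sum_nonneg)
    finally show ?thesis by simp
  next
    case False
    then have close: "\<bar>D u - D v\<bar> < \<eta>"
      if "u < m" "v < m" "k u \<le> Suc (k v)" "k v \<le> Suc (k u)" for u v
      using that by force
    define a where "a j = sum D (C j) / real (card (C j))" for j
    have a_close: "\<bar>a (k u) - D u\<bar> \<le> \<eta>" if "u < m" for u
      unfolding a_def using that neC[OF k[OF that]] close[OF _ that]
      by (intro abs_mean_diff_le) (auto simp: C_def less_imp_le)
    define p q where "p = min (k i) (k w)" and "q = max (k i) (k w)"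
    have pq: "p \<le> q" "q < n" using k i by (auto simp: p_def q_def)
    \<comment> \<open>Replacing a displacement by its cell average costs at most \<eta> at each end,
      which leaves half of the assumed \<open>4 * \<eta>\<close>.\<close>
    have "2 * \<eta> \<le> \<bar>a (k i) - a (k w)\<bar>"
      using a_close[OF i(1)] a_close[OF i(2)] i(3) by linarith
    also have "\<dots> = \<bar>a q - a p\<bar>" by (auto simp: p_def q_def min_def max_def)
    finally have "(2 * \<eta>)\<^sup>2 \<le> (a q - a p)\<^sup>2" using \<eta> by (metis abs_le_square_iff abs_of_nonneg mult_nonneg_nonneg less_imp_le zero_le_numeral)
    then have "4 * N\<^sup>2 * \<eta>\<^sup>2 / real n \<le> N\<^sup>2 * ((a q - a p)\<^sup>2 / real n)"
      using mult_left_mono[of "(2*\<eta>)\<^sup>2" "(a q - a p)\<^sup>2" "N\<^sup>2 / real n"]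
      by (simp add: power_mult_distrib mult.assoc mult.left_commute)
    also have "\<dots> \<le> N\<^sup>2 * (\<Sum>j<n - 1. (a (Suc j) - a j)\<^sup>2)"
      using sum_square_increments_ge[OF pq, of a] by (intro mult_left_mono) auto
    also have "\<dots> = (\<Sum>j<n - 1. N\<^sup>2 * (a (Suc j) - a j)\<^sup>2)" by (simp add: sum_distrib_left)
    also have "\<dots> \<le> (\<Sum>j<n - 1. \<Sum>u\<in>C (Suc j). \<Sum>v\<in>C j. (D u - D v)\<^sup>2)"
    proof (rule sum_mono)
      fix j assume "j \<in> {..<n - 1}"
      then have j: "j < n" "Suc j < n" by auto
      have "N * N \<le> real (card (C (Suc j))) * real (card (C j))"
        using cardC j N by (intro mult_mono) auto
      then have "N\<^sup>2 * (a (Suc j) - a j)\<^sup>2 \<le>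
          real (card (C (Suc j))) * real (card (C j)) * (a (Suc j) - a j)\<^sup>2"
        by (intro mult_right_mono) (auto simp: power2_eq_square)
      also have "\<dots> \<le> (\<Sum>u\<in>C (Suc j). \<Sum>v\<in>C j. (D u - D v)\<^sup>2)"
        unfolding a_def using j neC by (intro sum_square_diff_ge) auto
      finally show "N\<^sup>2 * (a (Suc j) - a j)\<^sup>2 \<le> (\<Sum>u\<in>C (Suc j). \<Sum>v\<in>C j. (D u - D v)\<^sup>2)" .
    qed
    also have "\<dots> \<le> (\<Sum>j<n - 1. \<Sum>u\<in>C (Suc j). \<Sum>v<m. h u v)"
    proof (intro sum_mono)
      fix j u assume "u \<in> C (Suc j)"
      then have u: "u < m" "k u = Suc j" by (auto simp: C_def)
      have "(\<Sum>v\<in>C j. (D u - D v)\<^sup>2) \<le> (\<Sum>v\<in>C j. h u v)"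
      proof (rule sum_mono)
        fix v assume "v \<in> C j"
        then have v: "v < m" "k v = j" by (auto simp: C_def)
        have "\<bar>D u - D v\<bar> < \<eta>" using close[of u v] u v by simp
        then have "min 1 \<bar>D u - D v\<bar> = \<bar>D u - D v\<bar>" using \<eta> by linarith
        then show "(D u - D v)\<^sup>2 \<le> h u v" using h[of u v] u v by simp
      qed
      also have "\<dots> \<le> (\<Sum>v<m. h u v)" by (rule sum_mono2) (auto simp: C_def h_nonneg)
      finally show "(\<Sum>v\<in>C j. (D u - D v)\<^sup>2) \<le> (\<Sum>v<m. h u v)" .
    qed
    \<comment> \<open>The cells are disjoint, so no row of the full double sum is used
      twice.\<close>
    also have "\<dots> = (\<Sum>u\<in>(\<Union>j<n - 1. C (Suc j)). \<Sum>v<m. h u v)"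
      by (subst sum.UNION_disjoint) (auto simp: C_def)
    also have "\<dots> \<le> (\<Sum>u<m. \<Sum>v<m. h u v)"
      by (rule sum_mono2) (auto simp: C_def h_nonneg sum_nonneg)
    finally show ?thesis by simp
  qed
qed

section \<open>Occupancy of intervals by random positions\<close>

text \<open>Chernoff bound for the lower tail: with p the measure of \<open>I\<close>, the mean of
  exp (- count) is at most exp (- p m / 2), and Markov's inequality at the threshold exp (- p m / 4)
  spends half of that exponent.\<close>

lemma measure_PiM_count_le:
  fixes M :: "'a measure" and m :: nat
  assumes "prob_space M" and I: "I \<in> sets M"
  defines "P \<equiv> Pi\<^sub>M {..<m} (\<lambda>_. M)"
  shows "measure P {x \<in> space P. real (card {i. i < m \<and> x i \<in> I}) \<le> measure M I * real m / 4}
    \<le> exp (- (measure M I * real m / 4))"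
proof -
  interpret M: prob_space M by fact
  interpret product_prob_space "\<lambda>_::nat. M" "{..<m}" by unfold_locales
  interpret PM: prob_space P unfolding P_def by (rule prob_space_PiM) (rule assms)
  define p where "p = measure M I"
  \<comment> \<open>This is \<open>exp (- indicator I y)\<close>, written as an affine function of
    the indicator so that its integral is explicit.\<close>
  define f :: "'a \<Rightarrow> real" where "f y = 1 - (1 - exp (- 1)) * indicator I y" for y
  have f_meas [measurable]: "f \<in> borel_measurable M"
    using I unfolding f_def by measurable
  have f01: "0 \<le> f y" "f y \<le> 1" for y by (auto simp: f_def indicator_def)
  have int_f: "integrable M f"
    by (rule M.integrable_const_bound[of _ 1]) (auto simp: f01)
  have int_I: "integrable M (indicator I :: 'a \<Rightarrow> real)"
    using I by (intro M.integrable_const_bound[of _ 1]) (auto simp: indicator_def)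
  have "integral\<^sup>L M f = 1 - (1 - exp (- 1)) * p"
    using I int_I unfolding f_def p_def
    by (subst Bochner_Integration.integral_diff) (auto simp: M.prob_space)
  also have "\<dots> \<le> 1 - p / 2"
  proof -
    have "exp (- 1 :: real) \<le> 1 / 2"
      using exp_ge_add_one_self[of "1::real"] by (simp add: exp_minus field_simps)
    then have "1 / 2 * p \<le> (1 - exp (- 1)) * p"
      by (intro mult_right_mono) (auto simp: p_def)
    then show ?thesis by simp
  qed
  also have "\<dots> \<le> exp (- (p / 2))" using exp_ge_add_one_self[of "- (p / 2)"] by simp
  finally have f_le: "integral\<^sup>L M f \<le> exp (- (p / 2))" .
  define F where "F x = (\<Prod>i<m. f (x i))" for x
  have F_meas: "F \<in> borel_measurable P" unfolding F_def P_def by measurable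
  have F_eq: "F x = exp (- real (card {i. i < m \<and> x i \<in> I}))" for x
  proof -
    have "F x = (\<Prod>i<m. if x i \<in> I then exp (- 1) else 1)"
      unfolding F_def by (intro prod.cong) (auto simp: f_def)
    also have "\<dots> = exp (- 1) ^ card {i. i < m \<and> x i \<in> I}"
      by (subst prod.If_cases) (auto simp: Int_def)
    finally show ?thesis by (simp flip: exp_of_nat_mult)
  qed
  have int_F: "integrable P F"
    by (rule PM.integrable_const_bound[of _ 1]) (auto simp: F_eq F_meas)
  have "{x \<in> space P. real (card {i. i < m \<and> x i \<in> I}) \<le> p * real m / 4}
      = {x \<in> space P. F x \<ge> exp (- (p * real m / 4))}"
    by (auto simp: F_eq)
  also have "measure P \<dots> \<le> integral\<^sup>L P F / exp (- (p * real m / 4))"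
    by (rule integral_Markov_inequality_measure[OF int_F, where A = "{}"]) (auto simp: F_eq)
  also have "integral\<^sup>L P F = (integral\<^sup>L M f) ^ m"
    unfolding P_def F_def using int_f by (subst product_integral_prod) auto
  also have "\<dots> \<le> exp (- (p / 2)) ^ m"
    using f_le by (intro power_mono) (auto simp: f01)
  also have "exp (- (p / 2)) ^ m / exp (- (p * real m / 4)) = exp (- (p * real m / 4))"
    by (simp flip: exp_of_nat_mult exp_diff)
  finally show ?thesis by (simp add: p_def divide_right_mono)
qed

text \<open>A union bound reduces the randomness of X to finitely many conditions: each set holds
  more than a quarter of its expected number of points. These conditions define a measurable event
  even if \<open>P\<close> does not.\<close>

lemma holds_with_prob_ge_uniform_positions:
  assumes "n > 0" "finite \<I>"
    and \<I>: "\<And>I. I \<in> \<I> \<Longrightarrow> I \<in> sets borel \<and> I \<subseteq> {0..real n} \<and> measure lborel I \<ge> l"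
    and hyp: "\<And>X. (\<And>i. i < m \<Longrightarrow> X i \<in> {0..<real n}) \<Longrightarrow>
      (\<And>I. I \<in> \<I> \<Longrightarrow> real (card {i. i < m \<and> X i \<in> I}) > measure lborel I * real m / (4 * real n)) \<Longrightarrow> P X"
  shows "holds_with_prob_ge (uniform_positions n m)
    (1 - real (card \<I>) * exp (- (l * real m / (4 * real n)))) P"
proof -
  define M where "M = uniform_measure lborel {0..real n}"
  have M: "prob_space M"
    unfolding M_def using assms(1) by (intro prob_space_uniform_measure) auto
  interpret M: prob_space M by (rule M)
  interpret product_prob_space "\<lambda>_::nat. M" "{..<m}" by unfold_locales
  define Q where "Q = Pi\<^sub>M {..<m} (\<lambda>_. M)"
  interpret Q: prob_space Q unfolding Q_def by (rule prob_space_PiM) (rule M)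
  have Q_eq: "uniform_positions n m = Q" by (simp add: uniform_positions_def Q_def M_def)
  have sets_M [measurable_cong]: "sets M = sets borel" by (simp add: M_def)
  have measure_M: "measure M I = measure lborel I / real n" if "I \<in> sets borel" "I \<subseteq> {0..real n}" for I
    unfolding M_def using that assms(1)
    by (subst measure_uniform_measure) (auto simp: Int_absorb1)
  define B where "B I = {x \<in> space Q. real (card {i. i < m \<and> x i \<in> I}) \<le> measure M I * real m / 4}" for I
  have B_sets: "B I \<in> sets Q" if "I \<in> \<I>" for I
  proof -
    have "I \<in> sets M" using \<I>[OF that] by (simp add: sets_M)
    have "(\<lambda>x. real (card {i. i < m \<and> x i \<in> I})) = (\<lambda>x. \<Sum>i<m. indicator I (x i))"
      by (auto simp: indicator_def sum.If_cases Int_def)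
    moreover have "(\<lambda>x. \<Sum>i<m. indicator I (x i) :: real) \<in> borel_measurable Q"
      unfolding Q_def using \<open>I \<in> sets M\<close>
      by (intro borel_measurable_sum measurable_compose[OF measurable_component_singleton]
          borel_measurable_indicator) auto
    ultimately have "(\<lambda>x. real (card {i. i < m \<and> x i \<in> I})) \<in> borel_measurable Q" by (simp only:)
    then show ?thesis unfolding B_def by (intro borel_measurable_le borel_measurable_const)
  qed
  have B_le: "measure Q (B I) \<le> exp (- (l * real m / (4 * real n)))" if "I \<in> \<I>" for I
  proof -
    have "measure Q (B I) \<le> exp (- (measure M I * real m / 4))"
      unfolding B_def Q_def using \<I>[OF that] by (intro measure_PiM_count_le M) (simp add: sets_M)
    also have "\<dots> \<le> exp (- (l * real m / (4 * real n)))"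
    proof -
      have "l * (real m / (4 * real n)) \<le> measure lborel I * (real m / (4 * real n))"
        using \<I>[OF that] by (intro mult_right_mono) auto
      then show ?thesis using \<I>[OF that] by (simp add: measure_M)
    qed
    finally show ?thesis .
  qed
  \<comment> \<open>The uniform law has no atom at n. Excluding that endpoint makes the floor of
    every position a cell index below n.\<close>
  define R where "R = {x \<in> space Q. \<forall>i<m. x i \<in> {0..<real n}}"
  have R_sets: "R \<in> sets Q" unfolding R_def Q_def by measurable
  have "AE y in M. y \<in> {0..<real n}"
  proof -
    have "AE y in lborel. y \<noteq> real n" by (rule AE_lborel_singleton)
    then have "AE y in lborel. y \<in> {0..real n} \<longrightarrow> y \<in> {0..<real n}" by eventually_elim auto
    then show ?thesis unfolding M_def by (intro AE_uniform_measureI) auto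
  qed
  then have "AE x in Q. \<forall>i\<in>{..<m}. x i \<in> {0..<real n}"
    unfolding Q_def by (intro AE_finite_allI AE_component) auto
  then have "AE x in Q. x \<in> R"
    using AE_space by eventually_elim (auto simp: R_def)
  then have R1: "measure Q R = 1"
    by (simp add: Q.prob_eq_1[OF R_sets])
  define A where "A = R - (\<Union>I\<in>\<I>. B I)"
  have "measure Q (\<Union>I\<in>\<I>. B I) \<le> (\<Sum>I\<in>\<I>. measure Q (B I))"
    using assms(2) B_sets by (intro Q.finite_measure_subadditive_finite) auto
  also have "\<dots> \<le> real (card \<I>) * exp (- (l * real m / (4 * real n)))"
    using B_le by (rule sum_bounded_above)
  finally have U: "measure Q (\<Union>I\<in>\<I>. B I) \<le> real (card \<I>) * exp (- (l * real m / (4 * real n)))" .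
  have U_sets: "(\<Union>I\<in>\<I>. B I) \<in> sets Q" using B_sets assms(2) by auto
  have A_sets: "A \<in> sets Q" unfolding A_def using R_sets U_sets by auto
  have "measure Q R \<le> measure Q (A \<union> (\<Union>I\<in>\<I>. B I))"
    using A_sets U_sets by (intro Q.finite_measure_mono sets.Un) (auto simp: A_def)
  also have "\<dots> \<le> measure Q A + measure Q (\<Union>I\<in>\<I>. B I)"
    using A_sets U_sets by (rule measure_Un_le)
  finally have "measure Q A \<ge> 1 - real (card \<I>) * exp (- (l * real m / (4 * real n)))"
    using U R1 by linarith
  moreover have "P x" if "x \<in> A" for x
  proof (rule hyp)
    fix I assume I: "I \<in> \<I>"
    have "x \<in> space Q" "x \<notin> B I" using that I by (auto simp: A_def R_def)
    then show "real (card {i. i < m \<and> x i \<in> I}) > measure lborel I * real m / (4 * real n)"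
      using \<I>[OF I] by (simp add: B_def measure_M)
  qed (use that in \<open>auto simp: A_def R_def\<close>)
  ultimately show ?thesis unfolding holds_with_prob_ge_def Q_eq using A_sets by blast
qed

section \<open>Total Hellinger distance for well-spread positions\<close>

lemma hellinger_nonneg: "0 \<le> hellinger X Y u v"
  by (simp add: hellinger_def)

text \<open>Unit cells suit \<open>chain_energy_ge\<close>, since points of neighbouring cells are
  at distance at most 2, as \<open>hellinger_ge\<close> requires. The choice \<eta> = e/8 works
  because a displacement beyond \<delta> \<ge> e differs from a suitable one near an end by more
  than 3e/4, hence by at least 4 \<eta>.\<close>

lemma sum_hellinger_ge:
  fixes X Y :: "nat \<Rightarrow> real"
  assumes X: "\<And>i. i < m \<Longrightarrow> X i \<in> {0..<real n}"
    and cells: "\<And>j. j < n \<Longrightarrow> real (card {i. i < m \<and> X i \<in> {real j..<real j + 1}}) \<ge> N"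
    and N: "N > 0"
    and e: "0 < e" "e \<le> 1" "e \<le> \<delta>"
    and low: "\<exists>i<m. X i \<le> e / 4" and high: "\<exists>i<m. X i \<ge> real n - e / 4"
    and Y: "Y \<in> position_vectors n m" "same_vertex_order m X Y" "far m \<delta> X Y"
  shows "(\<Sum>u<m. \<Sum>v<m. hellinger X Y u v) \<ge>
    min (N * (e / 8)\<^sup>2 / 4) (4 * N\<^sup>2 * (e / 8)\<^sup>2 / real n) / 100"
proof -
  define D where "D u = X u - Y u" for u
  define k where "k u = nat \<lfloor>X u\<rfloor>" for u
  have k_iff: "k u = j \<longleftrightarrow> X u \<in> {real j..<real j + 1}" if "u < m" for u j
    using X[OF that] by (auto simp: k_def nat_eq_iff floor_eq_iff)
  have k_bounds: "real (k u) \<le> X u" "X u < real (k u) + 1" if "u < m" for u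
    using k_iff[OF that, of "k u"] by auto
  have Y_bounds: "0 \<le> Y u" "Y u \<le> real n" if "u < m" for u
    using Y(1) that by (auto simp: position_vectors_def Pi_def)
  obtain i where i: "i < m" "\<bar>D i\<bar> > \<delta>" using Y(3) by (auto simp: far_def D_def)
  \<comment> \<open>Y stays in [0, n], so near the two ends D is bounded from one side; this rules out translations.\<close>
  obtain w where w: "w < m" "\<bar>D i - D w\<bar> \<ge> 4 * (e / 8)"
  proof (cases "D i > 0")
    case True
    obtain w where w: "w < m" "X w \<le> e / 4" using low by blast
    then have "D w \<le> e / 4" using Y_bounds[of w] by (simp add: D_def)
    then show ?thesis using that[of w] w True i e by auto
  next
    case False
    obtain w where w: "w < m" "X w \<ge> real n - e / 4" using high by blast
    then have "D w \<ge> - e / 4" using Y_bounds[of w] by (simp add: D_def)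
    then show ?thesis using that[of w] w False i e by auto
  qed
  \<comment> \<open>The factor 100 cancels the constant in \<open>hellinger_ge\<close>.\<close>
  have "min (N * (e / 8)\<^sup>2 / 4) (4 * N\<^sup>2 * (e / 8)\<^sup>2 / real n)
      \<le> (\<Sum>u<m. \<Sum>v<m. 100 * hellinger X Y u v)"
  proof (rule chain_energy_ge[where k = k and D = D and i = i and w = w])
    fix u assume "u < m"
    then have "real (k u) < real n" using k_bounds(1)[of u] X[of u] by simp
    then show "k u < n" by simp
  next
    fix j assume "j < n"
    have "{u. u < m \<and> k u = j} = {i. i < m \<and> X i \<in> {real j..<real j + 1}}"
      using k_iff by blast
    then show "N \<le> real (card {u. u < m \<and> k u = j})" using cells[OF \<open>j < n\<close>] by simp
  next
    fix u v assume uv: "u < m" "v < m" "k u \<le> Suc (k v)" "k v \<le> Suc (k u)"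
    then have "\<bar>X u - X v\<bar> \<le> 2" using k_bounds[of u] k_bounds[of v] by linarith
    then show "(min 1 \<bar>D u - D v\<bar>)\<^sup>2 \<le> 100 * hellinger X Y u v"
      using hellinger_ge[of u m v X Y] uv Y(2) by (simp add: D_def)
  qed (use i w e N in \<open>auto simp: hellinger_nonneg\<close>)
  then show ?thesis by (simp add: sum_distrib_left[symmetric])
qed

section \<open>Joining the bounds for positions and graphs\<close>

lemma holds_with_prob_ge_mono:
  assumes "holds_with_prob_ge M q P" "q' \<le> q" "\<And>x. P x \<Longrightarrow> P' x"
  shows "holds_with_prob_ge M q' P'"
proof -
  obtain A where "A \<in> sets M" "q \<le> measure M A" "\<forall>x\<in>A. P x"
    using assms(1) by (auto simp: holds_with_prob_ge_def)
  then show ?thesis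
    using assms(2,3) unfolding holds_with_prob_ge_def by (intro bexI[of _ A]) auto
qed

text \<open>The sets to be occupied are the n unit cells and two end intervals, hence the factor
  \<open>n + 2\<close>. The end intervals, of length \<open>e / 4\<close>, are the shortest and fix
  the exponent; \<open>N\<close> is a quarter of the expected number of points in a unit
  cell.\<close>

lemma uniform_positions_likelihood:
  fixes e \<delta> :: real
  assumes "n > 0" "m > 0" and e: "0 < e" "e \<le> 1" "e \<le> \<delta>"
  defines "N \<equiv> real m / (4 * real n)"
  defines "S \<equiv> min (N * (e / 8)\<^sup>2 / 4) (4 * N\<^sup>2 * (e / 8)\<^sup>2 / real n) / 100"
  shows "holds_with_prob_ge (uniform_positions n m) (1 - (real n + 2) * exp (- (e / 4 * N)))
    (\<lambda>X. \<forall>Y \<in> position_vectors n m. same_vertex_order m X Y \<longrightarrow> far m \<delta> X Y \<longrightarrow>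
       measure_pmf.prob (random_graph m X) {G. likelihood m X G > likelihood m Y G}
         \<ge> 1 - exp (- S / 4))"
    (is "holds_with_prob_ge _ _ ?P")
proof -
  define cell where "cell j = {real j..<real j + 1}" for j
  define low where "low = {0..e / 4}"
  define high where "high = {real n - e / 4..real n}"
  define \<I> where "\<I> = insert low (insert high (cell ` {..<n}))"
  have fin: "finite \<I>" by (simp add: \<I>_def)
  have sub: "I \<subseteq> {0..real n}" if "I \<in> \<I>" for I
    using that e assms(1) by (auto simp: \<I>_def low_def high_def cell_def)
  have meas: "I \<in> sets borel" if "I \<in> \<I>" for I
    using that by (auto simp: \<I>_def low_def high_def cell_def)
  have len: "measure lborel I \<ge> e / 4" if "I \<in> \<I>" for I
    using that e by (auto simp: \<I>_def low_def high_def cell_def)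
  have prob: "holds_with_prob_ge (uniform_positions n m)
      (1 - real (card \<I>) * exp (- (e / 4 * real m / (4 * real n)))) ?P"
  proof (rule holds_with_prob_ge_uniform_positions)
    fix X :: "nat \<Rightarrow> real"
    assume X: "\<And>i. i < m \<Longrightarrow> X i \<in> {0..<real n}"
      and "\<And>I. I \<in> \<I> \<Longrightarrow> real (card {i. i < m \<and> X i \<in> I}) > measure lborel I * real m / (4 * real n)"
    then have count: "real (card {i. i < m \<and> X i \<in> I}) > measure lborel I * N" if "I \<in> \<I>" for I
      using that by (simp add: N_def)
    have N_pos: "N > 0" using assms by (simp add: N_def)
    have ex: "\<exists>i<m. X i \<in> I" if "I \<in> \<I>" for I
    proof -
      have "0 < measure lborel I * N" using len[OF that] e N_pos by (intro mult_pos_pos) auto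
      then have "card {i. i < m \<and> X i \<in> I} \<noteq> 0" using count[OF that] by linarith
      then have "{i. i < m \<and> X i \<in> I} \<noteq> {}" by (metis card.empty)
      then show ?thesis by blast
    qed
    show "?P X"
    proof (intro ballI impI)
      \<comment> \<open>The occupancy conditions on X do not mention Y, so a single event serves all
        Y.\<close>
      fix Y assume Y: "Y \<in> position_vectors n m" "same_vertex_order m X Y" "far m \<delta> X Y"
      have "S \<le> (\<Sum>u<m. \<Sum>v<m. hellinger X Y u v)"
        unfolding S_def
      proof (rule sum_hellinger_ge[OF X _ N_pos e _ _ Y])
        fix j assume "j < n"
        then show "N \<le> real (card {i. i < m \<and> X i \<in> {real j..<real j + 1}})"
          using count[of "cell j"] by (simp add: \<I>_def cell_def)
      next
        show "\<exists>i<m. X i \<le> e / 4" using ex[of low] by (auto simp: \<I>_def low_def)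
        show "\<exists>i<m. X i \<ge> real n - e / 4" using ex[of high] by (auto simp: \<I>_def high_def)
      qed
      then have "exp (- (\<Sum>u<m. \<Sum>v<m. hellinger X Y u v) / 4) \<le> exp (- S / 4)" by simp
      then show "measure_pmf.prob (random_graph m X) {G. likelihood m X G > likelihood m Y G}
          \<ge> 1 - exp (- S / 4)"
        using prob_likelihood_gt[of X Y m] by linarith
    qed
  qed (use assms(1) fin sub meas len in auto)
  have "card \<I> \<le> Suc (Suc (card (cell ` {..<n})))"
    unfolding \<I>_def by (intro order.trans[OF card_insert_le_m1] card_insert_le_m1) auto
  also have "card (cell ` {..<n}) \<le> n" using card_image_le[of "{..<n}" cell] by simp
  finally have "real (card \<I>) \<le> real n + 2" by simp
  then have "real (card \<I>) * exp (- (e / 4 * real m / (4 * real n)))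
      \<le> (real n + 2) * exp (- (e / 4 * N))"
    by (simp add: N_def)
  then show ?thesis by (intro holds_with_prob_ge_mono[OF prob]) auto
qed

section \<open>Asymptotic choice of constants\<close>

text \<open>Bounding \<delta> by \<open>D\<close> makes the threshold for n uniform, so \<delta> may
  shrink as n grows; a constant \<delta> is the case \<open>D = \<delta>\<close>. The exponent 1
  serves both probabilities.\<close>

theorem theorem4p3:
  fixes D :: real
  assumes "D > 0"
  shows "\<exists>c>0. \<exists>N. \<forall>n\<ge>N. \<forall>\<delta> m.
    0 < \<delta> \<longrightarrow> \<delta> \<le> D \<longrightarrow>
    real n powr (3/2) * ln (real n) / \<delta> < real m \<longrightarrow> m < n ^ 2 \<longrightarrow>
    holds_with_prob_ge (uniform_positions n m) (1 - 1 / real n powr c)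
      (\<lambda>X. \<forall>Y \<in> position_vectors n m. same_vertex_order m X Y \<longrightarrow> far m \<delta> X Y \<longrightarrow>
         measure_pmf.prob (random_graph m X) {G. likelihood m X G > likelihood m Y G}
           \<ge> 1 - 1 / real n powr c)"
proof -
  \<comment> \<open>The energy bound caps differences at 1, so \<delta> will be replaced by
    \<open>min \<delta> 1\<close>; this costs at most the factor \<open>K\<close>.\<close>
  define K where "K = max D 1"
  have K: "K \<ge> 1" "D \<le> K" by (auto simp: K_def)
  \<comment> \<open>The constant 409600 is 4 * 102400 and yields \<open>S \<ge> 4 * L\<close> below.
    In the next condition 48 is 3 * 16, with 16 coming from \<open>e / 4 * N\<close>, and yields the
    exponent \<open>3 * L\<close>.\<close>
  have "eventually (\<lambda>n. ln (real n) \<ge> 409600 * K\<^sup>2) sequentially"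
    using filterlim_compose[OF ln_at_top filterlim_real_sequentially] by (simp add: filterlim_at_top)
  moreover have "eventually (\<lambda>n. sqrt (real n) \<ge> 48 * K) sequentially"
    using filterlim_compose[OF sqrt_at_top filterlim_real_sequentially] by (simp add: filterlim_at_top)
  moreover have "eventually (\<lambda>n. n \<ge> 2) sequentially" by (rule eventually_ge_at_top)
  ultimately have "eventually (\<lambda>n. ln (real n) \<ge> 409600 * K\<^sup>2 \<and> sqrt (real n) \<ge> 48 * K \<and> n \<ge> 2) sequentially"
    by eventually_elim auto
  then obtain N0 where N0: "\<And>n. n \<ge> N0 \<Longrightarrow>
      ln (real n) \<ge> 409600 * K\<^sup>2 \<and> sqrt (real n) \<ge> 48 * K \<and> n \<ge> 2"
    by (auto simp: eventually_sequentially)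
  show ?thesis
  proof (intro exI[of _ "1 :: real"] conjI exI[of _ N0] allI impI)
    fix n m :: nat and \<delta> :: real
    assume n: "n \<ge> N0" and \<delta>: "0 < \<delta>" "\<delta> \<le> D"
      and m_lower: "real n powr (3/2) * ln (real n) / \<delta> < real m" and m_upper: "m < n ^ 2"
    define s L e where "s = sqrt (real n)" and "L = ln (real n)" and "e = min \<delta> 1"
    have large: "L \<ge> 409600 * K\<^sup>2" "s \<ge> 48 * K" "n \<ge> 2"
      using N0[OF n] by (auto simp: s_def L_def)
    have n_pos: "real n > 0" and s_pos: "s > 0" and L_pos: "L > 0"
      using large(3) by (auto simp: s_def L_def)
    have s2: "s * s = real n" by (simp add: s_def)
    have exp_L: "exp (- L) = 1 / real n" using n_pos by (simp add: L_def exp_minus divide_simps)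
    have e: "0 < e" "e \<le> 1" "e \<le> \<delta>" using \<delta> by (auto simp: e_def)
    have \<delta>_le: "\<delta> \<le> K * e"
    proof (cases "\<delta> \<le> 1")
      case True
      then show ?thesis using K(1) \<delta> by (simp add: e_def)
    next
      case False
      then show ?thesis using K(2) \<delta> by (simp add: e_def)
    qed
    have "real n powr (3/2) = real n powr 1 * real n powr (1/2)"
      unfolding powr_add[symmetric] by simp
    also have "\<dots> = real n * s" using n_pos by (simp add: s_def powr_half_sqrt)
    finally have "real n * s * L < real m * \<delta>" using m_lower \<delta> by (simp add: field_simps L_def)
    also have "\<dots> \<le> real m * (K * e)" using \<delta>_le by (intro mult_left_mono) auto
    finally have nsL: "real n * s * L < real m * (K * e)" .
    then have "m > 0" using n_pos s_pos L_pos by (cases "m = 0") (auto simp: mult_less_0_iff)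
    have me: "s * L / K \<le> real m * e / real n"
      using nsL n_pos K(1) by (simp add: field_simps)
    \<comment> \<open>The only use of \<open>m < n\<^sup>2\<close>; it keeps \<open>N * e\<^sup>2\<close> above \<open>(ln n)\<^sup>2\<close>.\<close>
    have e_lower: "L / (K * s) \<le> e"
    proof -
      have "real m \<le> real n * real n" using m_upper by (simp flip: of_nat_mult add: power2_eq_square)
      then have "real m * (K * e) \<le> real n * real n * (K * e)"
        using K e by (intro mult_right_mono) auto
      then have "real n * (s * L) < real n * (real n * (K * e))" using nsL by (simp add: mult.assoc)
      then have "s * L < real n * (K * e)" using n_pos by (simp only: mult_less_cancel_left_pos)
      then have "s * L < s * (s * (K * e))" by (simp only: s2[symmetric] mult.assoc)
      then have "L < s * (K * e)" using s_pos by (simp only: mult_less_cancel_left_pos)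
      then have "L < e * (K * s)" by (simp only: ac_simps)
      moreover have "K * s > 0" using s_pos K by simp
      ultimately show ?thesis by (simp only: pos_divide_le_eq less_imp_le)
    qed
    define N where "N = real m / (4 * real n)"
    define S where "S = min (N * (e / 8)\<^sup>2 / 4) (4 * N\<^sup>2 * (e / 8)\<^sup>2 / real n) / 100"
    \<comment> \<open>One factor is bounded by \<open>me\<close> and the remaining \<open>e\<close>
      by \<open>e_lower\<close>, so that \<open>s\<close> cancels; 1024 is 4 * 64 * 4.\<close>
    have bound1: "L\<^sup>2 / K\<^sup>2 / 1024 \<le> N * (e / 8)\<^sup>2 / 4"
    proof -
      have "(s * L / K) * (L / (K * s)) \<le> (real m * e / real n) * e"
        using me e_lower K e s_pos L_pos by (intro mult_mono) auto
      moreover have "(s * L / K) * (L / (K * s)) = L\<^sup>2 / K\<^sup>2"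
        using s_pos by (simp add: power2_eq_square)
      moreover have "N * (e / 8)\<^sup>2 / 4 = (real m * e / real n) * e / 1024"
        by (simp add: N_def power2_eq_square)
      ultimately show ?thesis by (metis divide_right_mono zero_le_numeral)
    qed
    \<comment> \<open>Squaring \<open>me\<close> produces \<open>s * s = n\<close>, which cancels
      the chain length n; this is the purpose of the power 3/2 in the lower bound on
      \<open>m\<close>.\<close>
    have bound2: "L\<^sup>2 / K\<^sup>2 / 256 \<le> 4 * N\<^sup>2 * (e / 8)\<^sup>2 / real n"
    proof -
      have "(s * L / K)\<^sup>2 \<le> (real m * e / real n)\<^sup>2"
        using me K s_pos L_pos by (intro power_mono) auto
      moreover have "(s * L / K)\<^sup>2 = real n * (L\<^sup>2 / K\<^sup>2)"
        by (simp add: power_mult_distrib power_divide power2_eq_square[of s] s2)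
      ultimately have "L\<^sup>2 / K\<^sup>2 \<le> (real m * e / real n)\<^sup>2 / real n"
        using n_pos by (simp add: pos_le_divide_eq mult.commute)
      moreover have "4 * N\<^sup>2 * (e / 8)\<^sup>2 / real n = (real m * e / real n)\<^sup>2 / real n / 256"
        by (simp add: N_def power_mult_distrib power_divide)
      ultimately show ?thesis by (metis divide_right_mono zero_le_numeral)
    qed
    have min_ge: "r / 102400 \<le> min a b / 100" if "r / 1024 \<le> a" "r / 256 \<le> b" "0 \<le> r"
      for r a b :: real using that by linarith
    have "L\<^sup>2 / K\<^sup>2 / 102400 \<le> S"
      unfolding S_def by (rule min_ge[OF bound1 bound2]) simp
    moreover have "4 * L \<le> L\<^sup>2 / K\<^sup>2 / 102400"
      using mult_left_mono[OF large(1), of L] L_pos K by (simp add: field_simps power2_eq_square)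
    ultimately have "exp (- S / 4) \<le> exp (- L)" by simp
    then have graph: "exp (- S / 4) \<le> 1 / real n" by (simp add: exp_L)
    \<comment> \<open>The exponent \<open>3 * L\<close> absorbs the union bound: (n + 2) / n^3 is at
      most 1 / n once n is at least 2.\<close>
    have "(real n + 2) * exp (- (e / 4 * N)) \<le> (real n + 2) * exp (- (3 * L))"
    proof -
      have "48 * L \<le> s * L / K"
        using mult_right_mono[OF large(2), of L] L_pos K by (simp add: field_simps)
      then have "3 * L \<le> e / 4 * N" using me by (simp add: N_def mult.commute)
      then show ?thesis by (intro mult_left_mono) auto
    qed
    also have "\<dots> = (real n + 2) / real n ^ 3"
      using exp_of_nat_mult[of 3 "- L"] by (simp add: exp_L power_divide)
    also have "\<dots> \<le> (real n * real n) / real n ^ 3"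
    proof -
      have "2 * real n \<le> real n * real n" using large(3) by (intro mult_right_mono) auto
      then have "real n + 2 \<le> real n * real n" using large(3) by linarith
      then show ?thesis by (intro divide_right_mono) auto
    qed
    also have "\<dots> = 1 / real n" by (simp add: power3_eq_cube)
    finally have positions: "(real n + 2) * exp (- (e / 4 * N)) \<le> 1 / real n" .
    have main: "holds_with_prob_ge (uniform_positions n m) (1 - (real n + 2) * exp (- (e / 4 * N)))
      (\<lambda>X. \<forall>Y \<in> position_vectors n m. same_vertex_order m X Y \<longrightarrow> far m \<delta> X Y \<longrightarrow>
         measure_pmf.prob (random_graph m X) {G. likelihood m X G > likelihood m Y G}
           \<ge> 1 - exp (- S / 4))"
      unfolding S_def N_def using \<open>m > 0\<close> large(3) e
      by (intro uniform_positions_likelihood) auto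
    show "holds_with_prob_ge (uniform_positions n m) (1 - 1 / real n powr 1)
      (\<lambda>X. \<forall>Y \<in> position_vectors n m. same_vertex_order m X Y \<longrightarrow> far m \<delta> X Y \<longrightarrow>
         measure_pmf.prob (random_graph m X) {G. likelihood m X G > likelihood m Y G}
           \<ge> 1 - 1 / real n powr 1)"
    proof (rule holds_with_prob_ge_mono[OF main])
      show "1 - 1 / real n powr 1 \<le> 1 - (real n + 2) * exp (- (e / 4 * N))"
        using positions n_pos by simp
    next
      fix X
      assume *: "\<forall>Y \<in> position_vectors n m. same_vertex_order m X Y \<longrightarrow> far m \<delta> X Y \<longrightarrow>
           measure_pmf.prob (random_graph m X) {G. likelihood m X G > likelihood m Y G}
             \<ge> 1 - exp (- S / 4)"
      have "1 - 1 / real n powr 1 \<le> 1 - exp (- S / 4)" using graph n_pos by simp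
      then show "\<forall>Y \<in> position_vectors n m. same_vertex_order m X Y \<longrightarrow> far m \<delta> X Y \<longrightarrow>
           measure_pmf.prob (random_graph m X) {G. likelihood m X G > likelihood m Y G}
             \<ge> 1 - 1 / real n powr 1"
        by (intro ballI impI) (rule order.trans, use * in auto)
    qed
  qed simp
qed

end
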